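(* Let $(L,[\cdot,\cdot,\cdot],\alpha,\beta)$ be a real $3$-Bihom-Lie algebra. Then $L$ has a complex product structure if and only if $L$ has a complex structure $J$ and $L=L_+\oplus L_-$ (direct sum of vector spaces), where $L_+$ and $L_-$ are nonzero Bihom subalgebras of $L$ and $J(L_+)=L_-$.
   Context: A real $3$-Bihom-Lie algebra is a $4$-tuple $(L,[\cdot,\cdot,\cdot],\alpha,\beta)$ consisting of a real vector space $L$, a $3$-linear map $[\cdot,\cdot,\cdot]\colon L\times L\times L\to L$ and two linear maps $\alpha,\beta\colon L\to L$ such that for all $x,y,z,u,v\in L$: (1) $\alpha\beta=\beta\alpha$; (2) $\alpha([x,y,z])=[\alpha(x),\alpha(y),\alpha(z)]$ and $\beta([x,y,z])=[\beta(x),\beta(y),\beta(z)]$; (3) $[\beta(x),\beta(y),\alpha(z)]=-[\beta(y),\beta(x),\alpha(z)]=-[\beta(x),\beta(z),\alpha(y)]$; (4) $[\beta^2(u),\beta^2(v),[\beta(x),\beta(y),\alpha(z)]]=[\beta^2(y),\beta^2(z),[\beta(u),\beta(v),\alpha(x)]]-[\beta^2(x),\beta^2(z),[\beta(u),\beta(v),\alpha(y)]]+[\beta^2(x),\beta^2(y),[\beta(u),\beta(v),\alpha(z)]]$. A linear subspace $\eta\subseteq L$ is a Bihom subalgebra if $\alpha(\eta)\subseteq\eta$, $\beta(\eta)\subseteq\eta$ and $[x,y,z]\in\eta$ for all $x,y,z\in\eta$. A product structure on $L$ is a linear map $E\colon L\to L$ with $E^2=\mathrm{Id}$, $E\neq\pm\mathrm{Id}$,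 $\alpha E=E\alpha$, $\beta E=E\beta$ and, for all $x,y,z\in L$, $$E[x,y,z]=[Ex,Ey,Ez]+[Ex,y,z]+[x,Ey,z]+[x,y,Ez]-E[Ex,Ey,z]-E[x,Ey,Ez]-E[Ex,y,Ez].$$ A complex structure on $L$ is a linear map $J\colon L\to L$ with $J^2=-\mathrm{Id}$, $J\alpha=\alpha J$, $J\beta=\beta J$ and, for all $x,y,z\in L$, $$J[x,y,z]=-[Jx,Jy,Jz]+[Jx,y,z]+[x,Jy,z]+[x,y,Jz]+J[Jx,Jy,z]+J[x,Jy,Jz]+J[Jx,y,Jz].$$ A complex product structure on $L$ is a pair $(J,E)$ consisting of a complex structure $J$ and a product structure $E$ on $L$ such that $JE=-EJ$. *)

theory Defs
  imports Complex_Main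
begin

text \<open>The underlying real vector space \<open>L\<close> is an arbitrary type of class \<open>real_vector\<close>, of any
  dimension; the bracket is curried.\<close>

definition trilinear :: "('a::real_vector \<Rightarrow> 'a \<Rightarrow> 'a \<Rightarrow> 'a) \<Rightarrow> bool" where
  "trilinear br \<longleftrightarrow>
     (\<forall>y z. linear (\<lambda>x. br x y z)) \<and>
     (\<forall>x z. linear (\<lambda>y. br x y z)) \<and>
     (\<forall>x y. linear (\<lambda>z. br x y z))"

locale three_bihom_lie_algebra =
  fixes br :: "'a::real_vector \<Rightarrow> 'a \<Rightarrow> 'a \<Rightarrow> 'a"
    and \<alpha> \<beta> :: "'a \<Rightarrow> 'a"
  assumes trilinear_br: "trilinear br"
    and linear_alpha: "linear \<alpha>"
    and linear_beta: "linear \<beta>"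
    and alpha_beta_commute: "\<alpha> \<circ> \<beta> = \<beta> \<circ> \<alpha>"
    and alpha_br: "\<alpha> (br x y z) = br (\<alpha> x) (\<alpha> y) (\<alpha> z)"
    and beta_br: "\<beta> (br x y z) = br (\<beta> x) (\<beta> y) (\<beta> z)"
    and skew_12: "br (\<beta> x) (\<beta> y) (\<alpha> z) = - br (\<beta> y) (\<beta> x) (\<alpha> z)"
    and skew_23: "br (\<beta> x) (\<beta> y) (\<alpha> z) = - br (\<beta> x) (\<beta> z) (\<alpha> y)"
    and bihom_jacobi:
      "br (\<beta> (\<beta> u)) (\<beta> (\<beta> v)) (br (\<beta> x) (\<beta> y) (\<alpha> z)) =
         br (\<beta> (\<beta> y)) (\<beta> (\<beta> z)) (br (\<beta> u) (\<beta> v) (\<alpha> x))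
       - br (\<beta> (\<beta> x)) (\<beta> (\<beta> z)) (br (\<beta> u) (\<beta> v) (\<alpha> y))
       + br (\<beta> (\<beta> x)) (\<beta> (\<beta> y)) (br (\<beta> u) (\<beta> v) (\<alpha> z))"

definition bihom_subalgebra ::
  "('a::real_vector \<Rightarrow> 'a \<Rightarrow> 'a \<Rightarrow> 'a) \<Rightarrow> ('a \<Rightarrow> 'a) \<Rightarrow> ('a \<Rightarrow> 'a) \<Rightarrow> 'a set \<Rightarrow> bool" where
  "bihom_subalgebra br \<alpha> \<beta> S \<longleftrightarrow>
     subspace S \<and> \<alpha> ` S \<subseteq> S \<and> \<beta> ` S \<subseteq> S \<and>
     (\<forall>x\<in>S. \<forall>y\<in>S. \<forall>z\<in>S. br x y z \<in> S)"

definition product_structure ::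
  "('a::real_vector \<Rightarrow> 'a \<Rightarrow> 'a \<Rightarrow> 'a) \<Rightarrow> ('a \<Rightarrow> 'a) \<Rightarrow> ('a \<Rightarrow> 'a) \<Rightarrow> ('a \<Rightarrow> 'a) \<Rightarrow> bool" where
  "product_structure br \<alpha> \<beta> E \<longleftrightarrow>
     linear E \<and> E \<circ> E = id \<and> E \<noteq> id \<and> E \<noteq> uminus \<and>
     \<alpha> \<circ> E = E \<circ> \<alpha> \<and> \<beta> \<circ> E = E \<circ> \<beta> \<and>
     (\<forall>x y z. E (br x y z) =
        br (E x) (E y) (E z) + br (E x) y z + br x (E y) z + br x y (E z)
        - E (br (E x) (E y) z) - E (br x (E y) (E z)) - E (br (E x) y (E z)))"

definition complex_structure ::
  "('a::real_vector \<Rightarrow> 'a \<Rightarrow> 'a \<Rightarrow> 'a) \<Rightarrow> ('a \<Rightarrow> 'a) \<Rightarrow> ('a \<Rightarrow> 'a) \<Rightarrow> ('a \<Rightarrow> 'a) \<Rightarrow> bool" where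
  "complex_structure br \<alpha> \<beta> J \<longleftrightarrow>
     linear J \<and> J \<circ> J = uminus \<and>
     J \<circ> \<alpha> = \<alpha> \<circ> J \<and> J \<circ> \<beta> = \<beta> \<circ> J \<and>
     (\<forall>x y z. J (br x y z) =
        - br (J x) (J y) (J z) + br (J x) y z + br x (J y) z + br x y (J z)
        + J (br (J x) (J y) z) + J (br x (J y) (J z)) + J (br (J x) y (J z)))"

definition complex_product_structure ::
  "('a::real_vector \<Rightarrow> 'a \<Rightarrow> 'a \<Rightarrow> 'a) \<Rightarrow> ('a \<Rightarrow> 'a) \<Rightarrow> ('a \<Rightarrow> 'a) \<Rightarrow>
     ('a \<Rightarrow> 'a) \<Rightarrow> ('a \<Rightarrow> 'a) \<Rightarrow> bool" where
  "complex_product_structure br \<alpha> \<beta> J E \<longleftrightarrow>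
     complex_structure br \<alpha> \<beta> J \<and> product_structure br \<alpha> \<beta> E \<and>
     J \<circ> E = uminus \<circ> (E \<circ> J)"

definition is_direct_sum :: "'a::real_vector set \<Rightarrow> 'a set \<Rightarrow> bool" where
  "is_direct_sum A B \<longleftrightarrow>
     subspace A \<and> subspace B \<and> {a + b | a b. a \<in> A \<and> b \<in> B} = UNIV \<and> A \<inter> B = {0}"

end

theory Submission
  imports Defs
begin

text \<open>A product structure \<open>E\<close> amounts to a splitting of \<open>L\<close> into its two eigenspaces: on
  eigenvectors with signs \<open>s, t, u\<close> the integrability identity reads
  \<open>(1 + s t + t u + s u) E[x,y,z] = (s t u + s + t + u) [x,y,z]\<close>, which says that \<open>[x,y,z]\<close> lies
  in the common eigenspace if the signs agree, and \<open>0 = 0\<close> otherwise. Anticommutation with \<open>J\<close>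
  means that \<open>J\<close> exchanges the eigenspaces.\<close>

lemma eq_uminus_iff_zero:
  fixes x :: "'a::real_vector"
  shows "x = - x \<longleftrightarrow> x = 0"
proof
  assume "x = - x"
  then have "2 *\<^sub>R x = 0"
    unfolding scaleR_2 by (rule eq_neg_iff_add_eq_0[THEN iffD1])
  then show "x = 0" by simp
qed simp

lemma trilinear_add:
  assumes "trilinear br"
  shows "br (x + x') y z = br x y z + br x' y z"
    and "br x (y + y') z = br x y z + br x y' z"
    and "br x y (z + z') = br x y z + br x y z'"
  using assms linear_add[of "\<lambda>x. br x y z"] linear_add[of "\<lambda>y. br x y z"]
    linear_add[of "\<lambda>z. br x y z"]
  unfolding trilinear_def by blast+

lemma trilinear_minus:
  assumes "trilinear br"
  shows "br (- x) y z = - br x y z"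
    and "br x (- y) z = - br x y z"
    and "br x y (- z) = - br x y z"
  using assms linear_neg[of "\<lambda>x. br x y z"] linear_neg[of "\<lambda>y. br x y z"]
    linear_neg[of "\<lambda>z. br x y z"]
  unfolding trilinear_def by blast+

lemma trilinear_diff:
  assumes "trilinear br"
  shows "br (x - x') y z = br x y z - br x' y z"
    and "br x (y - y') z = br x y z - br x y' z"
    and "br x y (z - z') = br x y z - br x y z'"
  by (simp_all only: diff_conv_add_uminus trilinear_add[OF assms] trilinear_minus[OF assms])

text \<open>Keeping the eigenvalue as a parameter lets both signs be treated at once when closure
  under the bracket and the action of \<open>J\<close> are studied.\<close>

definition eigenspace :: "real \<Rightarrow> ('a::real_vector \<Rightarrow> 'a) \<Rightarrow> 'a set" where
  "eigenspace c E = {x. E x = c *\<^sub>R x}"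

lemma subspace_eigenspace: "linear E \<Longrightarrow> subspace (eigenspace c E)"
  unfolding subspace_def eigenspace_def
  by (auto simp: linear_0 linear_add linear_scale scaleR_add_right)

text \<open>The components of \<open>x\<close> are its images under the complementary projections (1
  + E)/2 and (1 - E)/2; applying \<open>E\<close> to them and using E E x = x shows in which
  eigenspace each lies. A common vector satisfies x = - x, hence vanishes.\<close>

lemma involution_direct_sum:
  assumes "linear E" "E \<circ> E = id"
  shows "is_direct_sum (eigenspace 1 E) (eigenspace (- 1) E)"
proof -
  have inv: "E (E x) = x" for x
    using assms(2) by (metis comp_apply id_apply)
  have "\<exists>a b. x = a + b \<and> a \<in> eigenspace 1 E \<and> b \<in> eigenspace (- 1) E" for x
  proof (intro exI conjI)
    show "x = (1/2) *\<^sub>R (x + E x) + (1/2) *\<^sub>R (x - E x)"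
      using scaleR_add_left[of "1/2" "1/2" x] by (simp add: scaleR_add_right scaleR_diff_right)
    show "(1/2) *\<^sub>R (x + E x) \<in> eigenspace 1 E" "(1/2) *\<^sub>R (x - E x) \<in> eigenspace (- 1) E"
      by (simp_all add: eigenspace_def linear_add[OF assms(1)] linear_diff[OF assms(1)]
          linear_scale[OF assms(1)] inv algebra_simps)
  qed
  then have "{a + b |a b. a \<in> eigenspace 1 E \<and> b \<in> eigenspace (- 1) E} = UNIV"
    by blast
  moreover have "eigenspace 1 E \<inter> eigenspace (- 1) E = {0}"
    using linear_0[OF assms(1)] eq_uminus_iff_zero by (fastforce simp: eigenspace_def)
  ultimately show ?thesis
    using subspace_eigenspace[OF assms(1)] unfolding is_direct_sum_def by simp
qed

text \<open>Some \<open>x\<close> with E x different from - x makes x + E x a nonzero vector of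
  eigenvalue 1, and some \<open>y\<close> with E y different from \<open>y\<close> makes y - E y a
  nonzero vector of eigenvalue -1.\<close>

lemma involution_eigenspace_nonzero:
  assumes "linear E" "E \<circ> E = id" "E \<noteq> id" "E \<noteq> uminus"
  shows "eigenspace 1 E \<noteq> {0}" "eigenspace (- 1) E \<noteq> {0}"
proof -
  have inv: "E (E x) = x" for x
    using assms(2) by (metis comp_apply id_apply)
  have plus: "x + E x \<in> eigenspace 1 E" and minus: "x - E x \<in> eigenspace (- 1) E" for x
    using inv assms(1) by (simp_all add: eigenspace_def linear_add linear_diff add.commute)
  obtain x y where "E x \<noteq> - x" "E y \<noteq> y"
    using assms(3,4) by (metis eq_id_iff ext)
  then show "eigenspace 1 E \<noteq> {0}" "eigenspace (- 1) E \<noteq> {0}"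
    using plus[of x] minus[of y]
    by (metis neg_eq_iff_add_eq_0 singletonD, metis right_minus_eq singletonD)
qed

lemma product_structure_eigenspace_subalgebra:
  assumes br: "trilinear br" and \<alpha>: "linear \<alpha>" and \<beta>: "linear \<beta>"
    and E: "product_structure br \<alpha> \<beta> E" and c: "c = 1 \<or> c = - 1"
  shows "bihom_subalgebra br \<alpha> \<beta> (eigenspace c E)"
proof -
  have lin: "linear E"
    and comm: "\<alpha> \<circ> E = E \<circ> \<alpha>" "\<beta> \<circ> E = E \<circ> \<beta>"
    and ident: "E (br x y z) =
        br (E x) (E y) (E z) + br (E x) y z + br x (E y) z + br x y (E z)
        - E (br (E x) (E y) z) - E (br x (E y) (E z)) - E (br (E x) y (E z))" for x y z
    using E unfolding product_structure_def by blast+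
  have commutes: "E (\<alpha> x) = \<alpha> (E x)" "E (\<beta> x) = \<beta> (E x)" for x
    using comm by (metis comp_apply)+
  have "br x y z \<in> eigenspace c E"
    if xyz: "x \<in> eigenspace c E" "y \<in> eigenspace c E" "z \<in> eigenspace c E" for x y z
  proof -
    \<comment> \<open>As c^2 = 1 and c^3 = c, the four terms outside \<open>E\<close> add up to 4 c
      [x,y,z] and the other three to - 3 E[x,y,z], which moves to the left.\<close>
    have "4 *\<^sub>R E (br x y z) = 4 *\<^sub>R c *\<^sub>R br x y z"
    proof -
      have eig: "E x = c *\<^sub>R x" "E y = c *\<^sub>R y" "E z = c *\<^sub>R z"
        using xyz by (simp_all add: eigenspace_def)
      have "4 *\<^sub>R v = v + v + v + v" for v :: 'a
        using scaleR_add_left[of 2 2 v] by (simp add: scaleR_2)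
      then show ?thesis
        using c ident[of x y z] unfolding eig
        by (elim disjE) (simp_all add: trilinear_minus[OF br] linear_neg[OF lin] algebra_simps)
    qed
    \<comment> \<open>Without \<open>scaleR_scaleR\<close> the factor 4 stays outermost on both
      sides and can be cancelled.\<close>
    then show ?thesis by (simp add: eigenspace_def del: scaleR_scaleR)
  qed
  then show ?thesis
    using subspace_eigenspace[OF lin] commutes linear_scale[OF \<alpha>] linear_scale[OF \<beta>]
    unfolding bihom_subalgebra_def by (auto simp: eigenspace_def)
qed

text \<open>Anticommutation makes \<open>J\<close> reverse the sign of an eigenvalue. Since J J =
  -1, the inverse of \<open>J\<close> is - J, which reverses signs as well, so the image is the
  whole opposite eigenspace.\<close>

lemma anticommuting_swaps_eigenspaces:
  assumes "linear J" "J \<circ> J = uminus" "J \<circ> E = uminus \<circ> (E \<circ> J)" "linear E"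
  shows "J ` eigenspace c E = eigenspace (- c) E"
proof -
  have JJ: "J (J x) = - x" for x
    using assms(2) by (metis comp_apply)
  have EJ: "E (J x) = - J (E x)" for x
    using fun_cong[OF assms(3), of x] by simp
  have maps: "J x \<in> eigenspace (- d) E" if "x \<in> eigenspace d E" for x d
    using that by (simp add: eigenspace_def EJ linear_scale[OF assms(1)])
  have "y \<in> J ` eigenspace c E" if "y \<in> eigenspace (- c) E" for y
  proof
    show "y = J (- J y)" by (simp add: linear_neg[OF assms(1)] JJ)
    show "- J y \<in> eigenspace c E"
      using maps[OF that] subspace_neg[OF subspace_eigenspace[OF assms(4)]] by simp
  qed
  then show ?thesis using maps by auto
qed

text \<open>The map is 2 p - 1 for the projection \<open>p\<close> onto \<open>A\<close> along
  \<open>B\<close>. Here \<open>p\<close> is first chosen pointwise; uniqueness of the decomposition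
  then makes it linear.\<close>

lemma direct_sum_reflection:
  assumes "is_direct_sum A B"
  obtains E where "linear E"
    "\<And>a. a \<in> A \<Longrightarrow> E a = a" "\<And>b. b \<in> B \<Longrightarrow> E b = - b"
proof -
  have A: "subspace A" and B: "subspace B" and int: "A \<inter> B = {0}"
    using assms by (auto simp: is_direct_sum_def)
  have "\<exists>p. p \<in> A \<and> x - p \<in> B" for x
  proof -
    have "x \<in> {a + b |a b. a \<in> A \<and> b \<in> B}"
      using assms by (simp add: is_direct_sum_def)
    then show ?thesis by force
  qed
  then obtain p where p: "p x \<in> A" "x - p x \<in> B" for x by metis
  have uniq: "p x = a" if "a \<in> A" "x - a \<in> B" for x a
  proof -
    \<comment> \<open>This is the difference of x - a and x - p x, both in \<open>B\<close>.\<close>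
    have "p x - a \<in> B" using subspace_diff[OF B that(2) p(2)[of x]] by simp
    then have "p x - a \<in> A \<inter> B" using subspace_diff[OF A p(1) that(1)] by simp
    then show ?thesis by (simp add: int)
  qed
  have "linear p"
  proof (rule linearI)
    show "p (x + y) = p x + p y" for x y
      using subspace_add[OF A p(1)[of x] p(1)[of y]] subspace_add[OF B p(2)[of x] p(2)[of y]]
      by (intro uniq) (simp_all add: algebra_simps)
    show "p (r *\<^sub>R x) = r *\<^sub>R p x" for r x
      using subspace_scale[OF A p(1)[of x], of r] subspace_scale[OF B p(2)[of x], of r]
      by (intro uniq) (simp_all add: algebra_simps)
  qed
  then have "linear (\<lambda>x. 2 *\<^sub>R p x - x)"
    by (auto intro!: linearI simp: linear_add linear_scale algebra_simps)
  \<comment> \<open>By uniqueness, \<open>p\<close> fixes \<open>A\<close> (decomposition a + 0) and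
    kills \<open>B\<close> (decomposition 0 + b).\<close>
  moreover have "2 *\<^sub>R p a - a = a" if "a \<in> A" for a
    using uniq[of a a] that subspace_0[OF B] by (simp add: scaleR_2)
  moreover have "2 *\<^sub>R p b - b = - b" if "b \<in> B" for b
    using uniq[of 0 b] that subspace_0[OF A] by simp
  ultimately show ?thesis by (rule that)
qed

text \<open>All equations can be checked on components from \<open>A\<close> and \<open>B\<close>,
  where \<open>E\<close> acts as a sign. Nonzero vectors in both summands rule out the identity and
  its negative.\<close>

lemma product_structure_of_subalgebras:
  assumes br: "trilinear br" and \<alpha>: "linear \<alpha>" and \<beta>: "linear \<beta>"
    and sum: "is_direct_sum A B"
    and A: "bihom_subalgebra br \<alpha> \<beta> A" "A \<noteq> {0}" and B: "bihom_subalgebra br \<alpha> \<beta> B" "B \<noteq> {0}"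
    and E: "linear E" "\<And>a. a \<in> A \<Longrightarrow> E a = a" "\<And>b. b \<in> B \<Longrightarrow> E b = - b"
  shows "product_structure br \<alpha> \<beta> E"
proof -
  have split: "\<exists>a\<in>A. \<exists>b\<in>B. x = a + b" for x
    using sum unfolding is_direct_sum_def by blast
  have mapsA: "\<alpha> a \<in> A" "\<beta> a \<in> A" if "a \<in> A" for a
    using A(1) that by (auto simp: bihom_subalgebra_def)
  have mapsB: "\<alpha> b \<in> B" "\<beta> b \<in> B" if "b \<in> B" for b
    using B(1) that by (auto simp: bihom_subalgebra_def)
  have "E (E x) = x" "\<alpha> (E x) = E (\<alpha> x)" "\<beta> (E x) = E (\<beta> x)" for x
  proof -
    obtain a b where "a \<in> A" "b \<in> B" "x = a + b" using split by blast
    then show "E (E x) = x" "\<alpha> (E x) = E (\<alpha> x)" "\<beta> (E x) = E (\<beta> x)"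
      using E mapsA mapsB
      by (simp_all add: linear_add linear_diff linear_neg \<alpha> \<beta>)
  qed
  then have "E \<circ> E = id" "\<alpha> \<circ> E = E \<circ> \<alpha>" "\<beta> \<circ> E = E \<circ> \<beta>"
    by (simp_all add: fun_eq_iff)
  moreover have "E \<noteq> id" "E \<noteq> uminus"
  proof -
    have "0 \<in> A" "0 \<in> B"
      using A(1) B(1) by (auto simp: bihom_subalgebra_def subspace_0)
    then obtain a b where "a \<in> A" "a \<noteq> 0" "b \<in> B" "b \<noteq> 0"
      using A(2) B(2) by blast
    then show "E \<noteq> id" "E \<noteq> uminus"
      using E(2)[of a] E(3)[of b] eq_uminus_iff_zero[of a] eq_uminus_iff_zero[of b] by auto
  qed
  moreover have "E (br x y z) =
        br (E x) (E y) (E z) + br (E x) y z + br x (E y) z + br x y (E z)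
        - E (br (E x) (E y) z) - E (br x (E y) (E z)) - E (br (E x) y (E z))" for x y z
  proof -
    obtain a b where x: "a \<in> A" "b \<in> B" "x = a + b" using split by blast
    obtain a' b' where y: "a' \<in> A" "b' \<in> B" "y = a' + b'" using split by blast
    obtain a'' b'' where z: "a'' \<in> A" "b'' \<in> B" "z = a'' + b''" using split by blast
    \<comment> \<open>Of the eight brackets of components, only these two need a known value under
      \<open>E\<close>; in the six mixed ones all coefficients cancel, wherever the bracket
      lies.\<close>
    have "br a a' a'' \<in> A" "br b b' b'' \<in> B"
      using A(1) B(1) x y z by (auto simp: bihom_subalgebra_def)
    then have brE: "E (br a a' a'') = br a a' a''" "E (br b b' b'') = - br b b' b''"
      using E by auto
    have Exyz: "E x = a - b" "E y = a' - b'" "E z = a'' - b''"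
      using x y z E by (simp_all add: linear_add)
    show ?thesis
      unfolding Exyz
      by (simp add: x(3) y(3) z(3) trilinear_add[OF br] trilinear_diff[OF br]
          linear_add[OF E(1)] linear_diff[OF E(1)] brE algebra_simps)
  qed
  ultimately show ?thesis
    using E(1) unfolding product_structure_def by blast
qed

theorem theorem4p26:
  fixes br :: "'a::real_vector \<Rightarrow> 'a \<Rightarrow> 'a \<Rightarrow> 'a"
    and \<alpha> \<beta> :: "'a \<Rightarrow> 'a"
  assumes "three_bihom_lie_algebra br \<alpha> \<beta>"
  shows "(\<exists>J E. complex_product_structure br \<alpha> \<beta> J E) \<longleftrightarrow>
    (\<exists>J L\<^sub>p L\<^sub>m. complex_structure br \<alpha> \<beta> J \<and>
       is_direct_sum L\<^sub>p L\<^sub>m \<and>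
       bihom_subalgebra br \<alpha> \<beta> L\<^sub>p \<and> bihom_subalgebra br \<alpha> \<beta> L\<^sub>m \<and>
       L\<^sub>p \<noteq> {0} \<and> L\<^sub>m \<noteq> {0} \<and>
       J ` L\<^sub>p = L\<^sub>m)"
proof -
  interpret three_bihom_lie_algebra br \<alpha> \<beta> by (fact assms)
  show ?thesis
  proof (intro iffI; elim exE conjE)
    fix J E
    assume "complex_product_structure br \<alpha> \<beta> J E"
    then have J: "complex_structure br \<alpha> \<beta> J" and E: "product_structure br \<alpha> \<beta> E"
      and JE: "J \<circ> E = uminus \<circ> (E \<circ> J)"
      by (auto simp: complex_product_structure_def)
    have E': "linear E" "E \<circ> E = id" "E \<noteq> id" "E \<noteq> uminus"
      using E by (auto simp: product_structure_def)
    have J': "linear J" "J \<circ> J = uminus"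
      using J by (auto simp: complex_structure_def)
    note subalg = product_structure_eigenspace_subalgebra[OF trilinear_br linear_alpha linear_beta E]
    show "\<exists>J L\<^sub>p L\<^sub>m. complex_structure br \<alpha> \<beta> J \<and> is_direct_sum L\<^sub>p L\<^sub>m \<and>
       bihom_subalgebra br \<alpha> \<beta> L\<^sub>p \<and> bihom_subalgebra br \<alpha> \<beta> L\<^sub>m \<and>
       L\<^sub>p \<noteq> {0} \<and> L\<^sub>m \<noteq> {0} \<and> J ` L\<^sub>p = L\<^sub>m"
      \<comment> \<open>The same \<open>J\<close> serves, with the eigenspaces of \<open>E\<close>
        for 1 and -1 as the two summands.\<close>
      using J involution_direct_sum[OF E'(1,2)] subalg[of 1] subalg[of "- 1"]
        involution_eigenspace_nonzero[OF E'] anticommuting_swaps_eigenspaces[OF J' JE E'(1), of 1]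
      by blast
  next
    fix J A B
    assume J: "complex_structure br \<alpha> \<beta> J" and sum: "is_direct_sum A B"
      and A: "bihom_subalgebra br \<alpha> \<beta> A" "A \<noteq> {0}" and B: "bihom_subalgebra br \<alpha> \<beta> B" "B \<noteq> {0}"
      and swap: "J ` A = B"
    obtain E where E: "linear E" "\<And>a. a \<in> A \<Longrightarrow> E a = a" "\<And>b. b \<in> B \<Longrightarrow> E b = - b"
      using direct_sum_reflection[OF sum] by blast
    have lin: "linear J" and JJ: "J (J x) = - x" for x
      using J unfolding complex_structure_def by (blast, metis comp_apply)
    have "J (E x) = - E (J x)" for x
    proof -
      obtain a b where ab: "a \<in> A" "b \<in> B" "x = a + b"
        using sum unfolding is_direct_sum_def by blast
      \<comment> \<open>Writing x = a + J c with \<open>a\<close> and \<open>c\<close> in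
        \<open>A\<close> expresses everything through \<open>A\<close>: J E x = J a + c, while E J x
        = E (J a - c) = - J a - c because J a lies in \<open>B\<close>.\<close>
      obtain c where "c \<in> A" "b = J c" using ab(2) swap by blast
      then show ?thesis
        using ab E swap
        by (auto simp: linear_add linear_diff linear_neg lin JJ)
    qed
    then have "J \<circ> E = uminus \<circ> (E \<circ> J)" by auto
    then show "\<exists>J E. complex_product_structure br \<alpha> \<beta> J E"
      using J product_structure_of_subalgebras[OF trilinear_br linear_alpha linear_beta sum A B E]
      unfolding complex_product_structure_def by blast
  qed
qed

end
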